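(* Let $n\ge 3$ be an integer and let $G$ be a finite solvable group such that the character degree graph $\Delta(G)$ has exactly $n$ vertices, has diameter $2$, is not a block, and has the structure $\Delta(G)=K_{n-(n_1+1)} - v - K_{n_1}$ with $n_1$ an integer satisfying $1\le n_1\le n-(n_1+1)$. Then the distance Laplacian spectrum of $\Delta(G)$ is $$\begin{pmatrix} 0 & 2n-1 & n & 2n-(n_1+1) & n+n_1\\ 1&1&1& n_1-1 & n-(n_1+2)\end{pmatrix}.$$
   Context: For a finite group $G$, $\mathrm{Irr}(G)$ is the set of complex irreducible characters of $G$, $\mathrm{cd}(G)=\{\chi(1) : \chi\in \mathrm{Irr}(G)\}$, and $\rho(G)$ is the set of primes dividing some element of $\mathrm{cd}(G)$. The character degree graph $\Delta(G)$ is the simple undirected graph with vertex set $\rho(G)$ in which distinct primes $p,q$ are adjacent if and only if $pq$ divides some $r\in \mathrm{cd}(G)$. A block of a graph is a maximal connected subgraph having no cut vertex of its own; a connected graph "is not a block" if it has a cut vertex. The notation $\Gamma=K_{a}-v-K_{b}$ means that the vertex set of $\Gamma$ is the disjoint union of a set $A$ of size $a$, a set $B$ of size $b$ and a single vertex $v$, where $A\cup\{v\}$ and $B\cup\{v\}$ each induce complete subgraphs and there are no edges between $A$ and $B$. For a connected finite simple graph $\Gamma$ with distance matrix $\mathcal D(\Gamma)=(d_{uv})$, the transmission of a vertex $v$ is $\mathrm{Tr}(v)=\sum_{u} d_{uv}$, and the distance Laplacian is $\mathcal D^L(\Gamma)=\mathrm{Tr}(\Gamma)-\mathcal D(\Gamma)$,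 where $\mathrm{Tr}(\Gamma)$ is the diagonal matrix of transmissions. The distance Laplacian spectrum is the multiset of eigenvalues of $\mathcal D^L(\Gamma)$, displayed as a two-row array with eigenvalues in the first row and their multiplicities in the second row (multiplicity $0$ means the column contributes nothing, and if two columns have the same eigenvalue their multiplicities are added). *)

theory Defs
  imports
    "HOL-Algebra.Solvable_Groups"
    "HOL-Computational_Algebra.Computational_Algebra"
    "Jordan_Normal_Form.VS_Connect"
    "Jordan_Normal_Form.Char_Poly"
    "Graph_Theory.Graph_Theory"
begin

section \<open>Complex irreducible characters and character degrees\<close>

abbreviation GL_complex :: "nat \<Rightarrow> complex mat monoid" where
  "GL_complex d \<equiv> units_of (ring_mat TYPE(complex) d ())"

definition representation ::
    "('a, 'b) monoid_scheme \<Rightarrow> nat \<Rightarrow> ('a \<Rightarrow> complex mat) \<Rightarrow> bool" where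
  "representation G d X \<longleftrightarrow> X \<in> hom G (GL_complex d)"

text \<open>The zero representation (\<open>d = 0\<close>) does not count as irreducible.\<close>

definition irreducible_representation ::
    "('a, 'b) monoid_scheme \<Rightarrow> nat \<Rightarrow> ('a \<Rightarrow> complex mat) \<Rightarrow> bool" where
  "irreducible_representation G d X \<longleftrightarrow>
     representation G d X \<and> 0 < d \<and>
     (\<forall>W. VectorSpace.subspace class_ring W (module_vec TYPE(complex) d) \<longrightarrow>
          (\<forall>g\<in>carrier G. \<forall>w\<in>W. X g *\<^sub>v w \<in> W) \<longrightarrow>
          W = {0\<^sub>v d} \<or> W = carrier_vec d)"

definition afforded_character ::
    "('a, 'b) monoid_scheme \<Rightarrow> ('a \<Rightarrow> complex mat) \<Rightarrow> 'a \<Rightarrow> complex" where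
  "afforded_character G X = restrict (\<lambda>g. sum_list (diag_mat (X g))) (carrier G)"

definition Irr :: "('a, 'b) monoid_scheme \<Rightarrow> ('a \<Rightarrow> complex) set" where
  "Irr G = {afforded_character G X |X d. irreducible_representation G d X}"

definition cd :: "('a, 'b) monoid_scheme \<Rightarrow> nat set" where
  "cd G = {m. \<exists>\<chi>\<in>Irr G. \<chi> \<one>\<^bsub>G\<^esub> = of_nat m}"

definition degree_primes :: "('a, 'b) monoid_scheme \<Rightarrow> nat set" where
  "degree_primes G = {p. prime p \<and> (\<exists>m\<in>cd G. p dvd m)}"

text \<open>Simple undirected graphs are loop-free symmetric digraphs, as in the theory
  \<^theory>\<open>Graph_Theory.Digraph\<close>.\<close>

definition character_degree_graph :: "('a, 'b) monoid_scheme \<Rightarrow> nat pair_pre_digraph" where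
  "character_degree_graph G =
     \<lparr> pverts = degree_primes G,
       parcs = {(p, q). p \<in> degree_primes G \<and> q \<in> degree_primes G \<and> p \<noteq> q \<and>
                        (\<exists>r\<in>cd G. p * q dvd r)} \<rparr>"


section \<open>Distances, blocks and the structure \<open>K\<^sub>a - v - K\<^sub>b\<close>\<close>

definition edge_dist :: "('v, 'e) pre_digraph \<Rightarrow> 'v \<Rightarrow> 'v \<Rightarrow> ereal" where
  "edge_dist \<Gamma> u v = wf_digraph.\<mu> \<Gamma> (\<lambda>_. 1) u v"

text \<open>The diameter of a disconnected graph is \<open>\<infinity>\<close>.\<close>

definition graph_diameter :: "('v, 'e) pre_digraph \<Rightarrow> ereal" where
  "graph_diameter \<Gamma> = (SUP (u, v)\<in>verts \<Gamma> \<times> verts \<Gamma>. edge_dist \<Gamma> u v)"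

text \<open>Reachability rather than \<^const>\<open>Digraph_Component.connected\<close> is used, because the
  latter fails for the empty graph, which would make the vertex of \<open>K\<^sub>1\<close> a cut vertex.\<close>

definition cut_vertex :: "('v, 'e) pre_digraph \<Rightarrow> 'v \<Rightarrow> bool" where
  "cut_vertex \<Gamma> c \<longleftrightarrow> c \<in> verts \<Gamma> \<and>
     (\<exists>u\<in>verts \<Gamma> - {c}. \<exists>w\<in>verts \<Gamma> - {c}.
        u \<rightarrow>\<^sup>*\<^bsub>\<Gamma>\<^esub> w \<and> \<not> u \<rightarrow>\<^sup>*\<^bsub>pre_digraph.del_vert \<Gamma> c\<^esub> w)"

definition is_block :: "('v, 'e) pre_digraph \<Rightarrow> bool" where
  "is_block \<Gamma> \<longleftrightarrow> Digraph_Component.connected \<Gamma> \<and> (\<nexists>c. cut_vertex \<Gamma> c)"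

definition two_cliques_at :: "('v, 'e) pre_digraph \<Rightarrow> nat \<Rightarrow> 'v \<Rightarrow> nat \<Rightarrow> bool" where
  "two_cliques_at \<Gamma> a v b \<longleftrightarrow>
     (\<exists>A B. finite A \<and> finite B \<and> card A = a \<and> card B = b \<and>
        A \<inter> B = {} \<and> v \<notin> A \<and> v \<notin> B \<and> verts \<Gamma> = A \<union> B \<union> {v} \<and>
        complete_digraph (a + 1) (\<Gamma> \<restriction> (A \<union> {v})) \<and>
        complete_digraph (b + 1) (\<Gamma> \<restriction> (B \<union> {v})) \<and>
        (\<forall>x\<in>A. \<forall>y\<in>B. \<not> x \<rightarrow>\<^bsub>\<Gamma>\<^esub> y \<and> \<not> y \<rightarrow>\<^bsub>\<Gamma>\<^esub> x))"


section \<open>The distance Laplacian\<close>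

text \<open>Rows and columns are indexed by the vertices in increasing order; the spectrum does not
  depend on the ordering. The conversion \<^const>\<open>real_of_ereal\<close> sends \<open>\<infinity>\<close> to \<open>0\<close>, so these
  notions are meaningful only for connected finite graphs.\<close>

definition vertex_list :: "('v :: linorder, 'e) pre_digraph \<Rightarrow> 'v list" where
  "vertex_list \<Gamma> = sorted_list_of_set (verts \<Gamma>)"

definition distance_matrix :: "('v :: linorder, 'e) pre_digraph \<Rightarrow> real mat" where
  "distance_matrix \<Gamma> =
     Matrix.mat (card (verts \<Gamma>)) (card (verts \<Gamma>))
       (\<lambda>(i, j). real_of_ereal (edge_dist \<Gamma> (vertex_list \<Gamma> ! i) (vertex_list \<Gamma> ! j)))"

definition transmission :: "('v, 'e) pre_digraph \<Rightarrow> 'v \<Rightarrow> real" where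
  "transmission \<Gamma> v = (\<Sum>u\<in>verts \<Gamma>. real_of_ereal (edge_dist \<Gamma> u v))"

definition distance_laplacian :: "('v :: linorder, 'e) pre_digraph \<Rightarrow> real mat" where
  "distance_laplacian \<Gamma> =
     mat_diag (card (verts \<Gamma>)) (\<lambda>i. transmission \<Gamma> (vertex_list \<Gamma> ! i)) - distance_matrix \<Gamma>"

text \<open>Eigenvalues with algebraic multiplicity, taken over the complex numbers.\<close>

definition distance_laplacian_spectrum ::
    "('v :: linorder, 'e) pre_digraph \<Rightarrow> complex multiset" where
  "distance_laplacian_spectrum \<Gamma> =
     proots (char_poly (map_mat complex_of_real (distance_laplacian \<Gamma>)))"

end

theory Submission
  imports Defs
begin

text \<open>
  Only the shape of the graph matters. For two cliques \<open>A\<close>, \<open>B\<close> of sizes \<open>a\<close>, \<open>b\<close> glued at \<open>v\<close>,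
  distances are \<open>2\<close> between \<open>A\<close> and \<open>B\<close> and \<open>1\<close> between other distinct vertices, so the
  distance Laplacian has an explicit eigenbasis: differences of two vertices of \<open>A\<close>
  (eigenvalue \<open>a + 2b + 1\<close>) or of \<open>B\<close> (eigenvalue \<open>2a + b + 1\<close>), the all-ones vector
  (eigenvalue \<open>0\<close>), the vector with entries \<open>b\<close> on \<open>A\<close>, \<open>-a\<close> on \<open>B\<close> and \<open>0\<close> at \<open>v\<close>
  (eigenvalue \<open>2(a + b) + 1\<close>), and the vector with entries \<open>1\<close> on \<open>A \<union> B\<close> and \<open>-(a + b)\<close> at
  \<open>v\<close> (eigenvalue \<open>a + b + 1\<close>).
\<close>

section \<open>Distances attained by short walks\<close>

lemma edge_dist_eqI:
  assumes "wf_digraph \<Gamma>" and "pre_digraph.awalk \<Gamma> u p w"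
    and "\<And>q. pre_digraph.awalk \<Gamma> u q w \<Longrightarrow> length p \<le> length q"
  shows "edge_dist \<Gamma> u w = ereal (length p)"
proof -
  interpret wf_digraph \<Gamma> by fact
  have cost: "awalk_cost (\<lambda>_. 1) q = real (length q)" for q :: "'b list"
    by (induction q) auto
  \<comment> \<open>With unit weights the cost of a walk is its length, so the distance is an
    infimum of lengths, attained at \<open>p\<close>.\<close>
  have "edge_dist \<Gamma> u w = (INF q\<in>{q. pre_digraph.awalk \<Gamma> u q w}. ereal (length q))"
    unfolding edge_dist_def \<mu>_def cost ..
  also have "\<dots> = ereal (length p)"
    using assms(2,3) by (intro antisym INF_lower INF_greatest) auto
  finally show ?thesis .
qed

lemma edge_dist_self:
  assumes "wf_digraph \<Gamma>" and "u \<in> verts \<Gamma>"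
  shows "edge_dist \<Gamma> u u = 0"
  using edge_dist_eqI[OF assms(1), of u "[]" u] assms(2)
  by (simp add: pre_digraph.awalk_def pre_digraph.cas.simps zero_ereal_def)

lemma edge_dist_adjacent:
  assumes "wf_digraph \<Gamma>" and "u \<rightarrow>\<^bsub>\<Gamma>\<^esub> w" and "u \<noteq> w"
  shows "edge_dist \<Gamma> u w = 1"
proof -
  interpret wf_digraph \<Gamma> by fact
  obtain e where e: "e \<in> arcs \<Gamma>" "tail \<Gamma> e = u" "head \<Gamma> e = w"
    using assms(2) by blast
  have "1 \<le> length q" if "awalk u q w" for q
    using that assms(3) by (cases q) (auto simp: awalk_Nil_iff)
  then show ?thesis
    using edge_dist_eqI[OF assms(1), of u "[e]" w] e
    by (auto simp: awalk_Cons_iff awalk_Nil_iff one_ereal_def)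
qed

lemma edge_dist_common_neighbour:
  assumes "wf_digraph \<Gamma>" and "u \<rightarrow>\<^bsub>\<Gamma>\<^esub> x" and "x \<rightarrow>\<^bsub>\<Gamma>\<^esub> w"
    and "u \<noteq> w" and "\<not> u \<rightarrow>\<^bsub>\<Gamma>\<^esub> w"
  shows "edge_dist \<Gamma> u w = 2"
proof -
  interpret wf_digraph \<Gamma> by fact
  obtain d where d: "d \<in> arcs \<Gamma>" "tail \<Gamma> d = u" "head \<Gamma> d = x"
    using assms(2) by blast
  obtain e where e: "e \<in> arcs \<Gamma>" "tail \<Gamma> e = x" "head \<Gamma> e = w"
    using assms(3) by blast
  have "length [d, e] \<le> length q" if "awalk u q w" for q
  proof (rule ccontr)
    assume "\<not> length [d, e] \<le> length q"
    \<comment> \<open>A shorter walk is empty, forcing \<open>u = w\<close>, or a single arc from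
      \<open>u\<close> to \<open>w\<close>; the borrowed case rule only splits lists into empty,
      singleton and longer.\<close>
    then consider "q = []" | c where "q = [c]"
      by (cases q rule: remdups_adj.cases) auto
    then show False
    proof cases
      case 1
      then show ?thesis using that assms(4) by (simp add: awalk_Nil_iff)
    next
      case 2
      then have "c \<in> arcs \<Gamma>" "tail \<Gamma> c = u" "head \<Gamma> c = w"
        using that by (auto simp: awalk_Cons_iff awalk_Nil_iff)
      then show ?thesis using assms(5) by (auto simp: arcs_ends_conv)
    qed
  qed
  moreover have "awalk u [d, e] w"
    using d e by (auto simp: awalk_Cons_iff awalk_Nil_iff)
  ultimately show ?thesis
    using edge_dist_eqI[OF assms(1), of u "[d, e]" w] by simp
qed

section \<open>Spectrum from an eigenbasis\<close>

lemma proots_prod_list_linear: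
  "proots (\<Prod>a\<leftarrow>as. [:- a, 1:]) = mset (as :: complex list)"
proof (induction as)
  case (Cons a as)
  have "(\<Prod>a\<leftarrow>as. [:- a, 1:]) \<noteq> 0"
    by auto
  then show ?case
    using Cons proots_mult[of "[:- a, 1:]"] by (auto simp del: mult_pCons_left)
qed simp

text \<open>Column \<open>j\<close> of \<open>p\<close> is an eigenvector for \<open>l j\<close>.
  Labelling the columns by the coordinate set makes their matrix square, and independence makes it
  invertible, so it conjugates the given matrix to the diagonal one.\<close>

lemma proots_char_poly_eigenbasis:
  fixes f p :: "'v \<Rightarrow> 'v \<Rightarrow> complex" and l :: "'v \<Rightarrow> complex"
  assumes dist: "distinct xs"
    and eig: "\<And>u j. u \<in> set xs \<Longrightarrow> j \<in> set xs \<Longrightarrow>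
                (\<Sum>w\<in>set xs. f u w * p w j) = p u j * l j"
    and indep: "\<And>c j. (\<And>u. u \<in> set xs \<Longrightarrow> (\<Sum>j\<in>set xs. p u j * c j) = 0) \<Longrightarrow>
                j \<in> set xs \<Longrightarrow> c j = 0"
  shows "proots (char_poly (Matrix.mat (length xs) (length xs) (\<lambda>(i, j). f (xs ! i) (xs ! j)))) =
           image_mset l (mset xs)"
proof -
  define n where "n = length xs"
  define A where "A = Matrix.mat n n (\<lambda>(i, j). f (xs ! i) (xs ! j))"
  define P where "P = Matrix.mat n n (\<lambda>(i, j). p (xs ! i) (xs ! j))"
  define D where "D = mat_diag n (\<lambda>i. l (xs ! i))"
  have carr: "A \<in> carrier_mat n n" "P \<in> carrier_mat n n" "D \<in> carrier_mat n n"
    by (auto simp: A_def P_def D_def)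
  have bij: "bij_betw ((!) xs) {0..<n} (set xs)"
    using dist by (auto simp: n_def atLeast0LessThan intro: bij_betw_nth)
  have sum_nth: "(\<Sum>i = 0..<n. g (xs ! i)) = (\<Sum>w\<in>set xs. g w)" for g :: "'v \<Rightarrow> complex"
    by (rule sum.reindex_bij_betw[OF bij])
  have AP: "A * P = P * D"
  proof (rule eq_matI)
    fix i j assume "i < dim_row (P * D)" "j < dim_col (P * D)"
    then have ij: "i < n" "j < n" using carr by auto
    then have "(A * P) $$ (i, j) = (\<Sum>k = 0..<n. f (xs ! i) (xs ! k) * p (xs ! k) (xs ! j))"
      by (simp add: A_def P_def scalar_prod_def)
    also have "\<dots> = (\<Sum>w\<in>set xs. f (xs ! i) w * p w (xs ! j))"
      by (rule sum_nth)
    also have "\<dots> = p (xs ! i) (xs ! j) * l (xs ! j)"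
      using ij by (simp add: eig n_def)
    also have "\<dots> = (P * D) $$ (i, j)"
      using ij carr(2) by (simp add: D_def mat_diag_mult_right[of _ n n]) (simp add: P_def)
    finally show "(A * P) $$ (i, j) = (P * D) $$ (i, j)" .
  qed (use carr in auto)
  have "det P \<noteq> 0"
  proof
    assume "det P = 0"
    then obtain y where y: "y \<in> carrier_vec n" "y \<noteq> 0\<^sub>v n" "P *\<^sub>v y = 0\<^sub>v n"
      using det_0_iff_vec_prod_zero_field[OF carr(2)] by auto
    \<comment> \<open>The kernel vector \<open>y\<close>, indexed by positions, is carried over to
      the labels so that \<open>indep\<close> applies.\<close>
    define c where "c w = y $ the_inv_into {0..<n} ((!) xs) w" for w
    have c: "c (xs ! i) = y $ i" if "i < n" for i
      using the_inv_into_f_f[OF bij_betw_imp_inj_on[OF bij]] that by (simp add: c_def)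
    have "(\<Sum>j\<in>set xs. p u j * c j) = 0" if u: "u \<in> set xs" for u
    proof -
      obtain i where i: "i < n" "u = xs ! i"
        using u by (auto simp: in_set_conv_nth n_def)
      have "(\<Sum>j\<in>set xs. p u j * c j) = (\<Sum>j = 0..<n. p u (xs ! j) * y $ j)"
        by (simp add: sum_nth[symmetric] c)
      also have "\<dots> = (P *\<^sub>v y) $ i"
        using i y(1) by (simp add: P_def scalar_prod_def)
      finally show ?thesis using i y(3) by simp
    qed
    then have "c j = 0" if "j \<in> set xs" for j
      using indep that by blast
    then have "y $ i = 0" if "i < n" for i
      using c that by (metis n_def nth_mem)
    then show False using y(1,2) by auto
  qed
  then obtain Q where Q: "Q \<in> carrier_mat n n" "P * Q = 1\<^sub>m n" "Q * P = 1\<^sub>m n"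
    using det_non_zero_imp_unit[OF carr(2)]
    by (auto simp: Units_def ring_mat_def)
  have "A = A * (P * Q)" using carr Q by simp
  also have "\<dots> = P * D * Q"
    using carr Q AP by (metis assoc_mult_mat)
  finally have "similar_mat A D"
    using carr Q by (intro similar_matI[of _ _ P Q n]) auto
  then have "char_poly A = char_poly D" by (rule char_poly_similar)
  also have "\<dots> = (\<Prod>a\<leftarrow>diag_mat D. [:- a, 1:])"
    by (rule char_poly_upper_triangular[OF carr(3)])
      (simp add: D_def mat_diag_def upper_triangular_def)
  finally have "char_poly A = (\<Prod>a\<leftarrow>diag_mat D. [:- a, 1:])" .
  moreover have "diag_mat D = map l xs"
    by (auto simp: diag_mat_def D_def mat_diag_def n_def intro: nth_equalityI)
  ultimately show ?thesis
    by (simp add: proots_prod_list_linear A_def n_def del: map_map)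
qed

section \<open>Two cliques glued at a vertex\<close>

lemma complete_induced_dominates:
  assumes "K\<^bsub>k\<^esub> (\<Gamma> \<restriction> C)" and "u \<in> C" and "w \<in> C" and "u \<noteq> w"
  shows "u \<rightarrow>\<^bsub>\<Gamma>\<^esub> w"
proof -
  have "(u, w) \<in> arcs_ends (\<Gamma> \<restriction> C)"
    using assms by (simp add: complete_digraph_def)
  then show ?thesis by (auto simp: arcs_ends_conv)
qed

text \<open>
  Linear independence of the eigenbasis: \<open>c j\<close> is the coefficient of the eigenvector labelled by
  the vertex \<open>j\<close>, and the hypotheses are the coordinates of a vanishing combination. The label
  \<open>v\<close> stands for the all-ones vector, \<open>a\<^sub>0\<close> and \<open>b\<^sub>0\<close> for the vectors with eigenvalues
  \<open>2(a + b) + 1\<close> and \<open>a + b + 1\<close>, and any other \<open>j\<close> for \<open>e\<^sub>j - e\<^sub>a\<^sub>0\<close> or \<open>e\<^sub>j - e\<^sub>b\<^sub>0\<close>.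
\<close>

lemma two_cliques_eigenvectors_independent:
  fixes c :: "'v \<Rightarrow> complex"
  assumes fin: "finite A" "finite B" and a0: "a\<^sub>0 \<in> A" and b0: "b\<^sub>0 \<in> B"
    and onA: "\<And>u. u \<in> A \<Longrightarrow>
      (\<Sum>j\<in>A - {a\<^sub>0}. (of_bool (u = j) - of_bool (u = a\<^sub>0)) * c j)
        + of_nat (card B) * c a\<^sub>0 + c b\<^sub>0 + c v = 0"
    and onB: "\<And>u. u \<in> B \<Longrightarrow>
      (\<Sum>j\<in>B - {b\<^sub>0}. (of_bool (u = j) - of_bool (u = b\<^sub>0)) * c j)
        - of_nat (card A) * c a\<^sub>0 + c b\<^sub>0 + c v = 0"
    and onv: "c v = of_nat (card A + card B) * c b\<^sub>0"
    and j: "j \<in> A \<union> B \<union> {v}"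
  shows "c j = 0"
proof -
  \<comment> \<open>Each coordinate other than \<open>c\<^sub>0\<close> gives
    \<open>c j = - \<alpha>\<close>; the coordinate \<open>c\<^sub>0\<close> then reads
    \<open>card C * \<alpha> = 0\<close>.\<close>
  have key: "\<alpha> = 0 \<and> (\<forall>j\<in>C - {c\<^sub>0}. c j = 0)"
    if C: "finite C" "c\<^sub>0 \<in> C"
      and eq: "\<And>u. u \<in> C \<Longrightarrow>
        (\<Sum>j\<in>C - {c\<^sub>0}. (of_bool (u = j) - of_bool (u = c\<^sub>0)) * c j) + \<alpha> = 0"
    for C c\<^sub>0 \<alpha>
  proof -
    have "c j = - \<alpha>" if "j \<in> C - {c\<^sub>0}" for j
    proof -
      have "(\<Sum>i\<in>C - {c\<^sub>0}. (of_bool (j = i) - of_bool (j = c\<^sub>0)) * c i) = c j"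
        using that C by (subst sum.remove[of _ j]) auto
      then show ?thesis using eq[of j] that by (simp add: add_eq_0_iff)
    qed note cj = this
    have "(\<Sum>i\<in>C - {c\<^sub>0}. (of_bool (c\<^sub>0 = i) - of_bool (c\<^sub>0 = c\<^sub>0)) * c i) = (\<Sum>i\<in>C - {c\<^sub>0}. \<alpha>)"
      using cj by (intro sum.cong) auto
    then have "of_nat (card (C - {c\<^sub>0}) + 1) * \<alpha> = 0"
      using eq[OF C(2)] by (simp add: algebra_simps)
    then have "\<alpha> = 0" by (simp del: of_nat_Suc of_nat_add)
    then show ?thesis using cj by simp
  qed
  have A: "of_nat (card B) * c a\<^sub>0 + c b\<^sub>0 + c v = 0 \<and> (\<forall>j\<in>A - {a\<^sub>0}. c j = 0)"
    using onA by (intro key[OF fin(1) a0]) (auto simp: add.assoc)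
  have B: "- of_nat (card A) * c a\<^sub>0 + c b\<^sub>0 + c v = 0 \<and> (\<forall>j\<in>B - {b\<^sub>0}. c j = 0)"
    using onB by (intro key[OF fin(2) b0]) (auto simp: algebra_simps)
  have pos: "card A + card B \<noteq> 0" "card A + card B + 1 \<noteq> 0"
    using a0 fin(1) by auto
  \<comment> \<open>Subtracting the relation on \<open>B\<close> from the one on \<open>A\<close>
    isolates \<open>c a\<^sub>0\<close>; inserting \<open>onv\<close> into what remains isolates
    \<open>c b\<^sub>0\<close>.\<close>
  have "of_nat (card A + card B) * c a\<^sub>0 = 0"
    using arg_cong2[OF conjunct1[OF A] conjunct1[OF B], of "(-)"] by (simp add: algebra_simps)
  then have ca: "c a\<^sub>0 = 0" using pos by (metis mult_eq_0_iff of_nat_eq_0_iff)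
  have "of_nat (card A + card B + 1) * c b\<^sub>0 = 0"
    using A onv ca by (simp add: algebra_simps)
  then have "c b\<^sub>0 = 0" using pos by (metis mult_eq_0_iff of_nat_eq_0_iff)
  then show ?thesis using A B ca onv j by auto
qed

text \<open>Both cliques have a vertex besides \<open>v\<close>. One in each serves as base point
  for the differences, and its label is freed for another eigenvector.\<close>

lemma distance_laplacian_spectrum_two_cliques:
  fixes \<Gamma> :: "('v :: linorder, 'e) pre_digraph"
  assumes wf: "wf_digraph \<Gamma>" and tc: "two_cliques_at \<Gamma> a v b" and ab: "1 \<le> a" "1 \<le> b"
  shows "distance_laplacian_spectrum \<Gamma> =
           {#0, of_nat (2 * (a + b) + 1), of_nat (a + b + 1)#}
         + replicate_mset (b - 1) (of_nat (2 * a + b + 1))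
         + replicate_mset (a - 1) (of_nat (a + 2 * b + 1))"
proof -
  obtain A B where fin: "finite A" "finite B" and card: "card A = a" "card B = b"
    and disj: "A \<inter> B = {}" "v \<notin> A" "v \<notin> B" and V: "verts \<Gamma> = A \<union> B \<union> {v}"
    and KA: "K\<^bsub>a + 1\<^esub> (\<Gamma> \<restriction> (A \<union> {v}))" and KB: "K\<^bsub>b + 1\<^esub> (\<Gamma> \<restriction> (B \<union> {v}))"
    and non: "\<And>x y. x \<in> A \<Longrightarrow> y \<in> B \<Longrightarrow> \<not> x \<rightarrow>\<^bsub>\<Gamma>\<^esub> y \<and> \<not> y \<rightarrow>\<^bsub>\<Gamma>\<^esub> x"
    using tc unfolding two_cliques_at_def by blast
  have neq: "x \<noteq> y" "y \<noteq> x" "x \<noteq> v" "v \<noteq> x" "y \<noteq> v" "v \<noteq> y" "x \<notin> B" "y \<notin> A"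
    if "x \<in> A" "y \<in> B" for x y
    using that disj by auto
  define xs where "xs = vertex_list \<Gamma>"
  have finV: "finite (verts \<Gamma>)" using fin by (simp add: V)
  have xs: "distinct xs" "set xs = A \<union> B \<union> {v}" "length xs = card (verts \<Gamma>)"
    using finV unfolding V[symmetric] by (simp_all add: xs_def vertex_list_def)
  have sumV: "(\<Sum>w\<in>A \<union> B \<union> {v}. g w) = sum g A + sum g B + g v" for g :: "'v \<Rightarrow> 'c :: comm_monoid_add"
    using fin disj by (simp add: sum.union_disjoint add.commute)

  \<comment> \<open>Distances in the glued cliques\<close>
  define d where "d u w = real_of_ereal (edge_dist \<Gamma> u w)" for u w
  have d_self: "d u u = 0" if "u \<in> A \<union> B \<union> {v}" for u
    using edge_dist_self[OF wf, of u] that by (simp add: d_def V)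
  have d_adj: "d u w = 1" if "u \<in> A \<union> {v} \<and> w \<in> A \<union> {v} \<or> u \<in> B \<union> {v} \<and> w \<in> B \<union> {v}" "u \<noteq> w" for u w
    using that edge_dist_adjacent[OF wf] complete_induced_dominates[OF KA, of u w]
      complete_induced_dominates[OF KB, of u w] by (auto simp: d_def)
  have d_v: "d u v = 1" "d v u = 1" if "u \<in> A \<union> B" for u
    using that disj by (auto intro: d_adj)
  \<comment> \<open>The common neighbour is \<open>v\<close>.\<close>
  have d_AB: "d x y = 2" "d y x = 2" if "x \<in> A" "y \<in> B" for x y
    using that neq[OF that] non[OF that] edge_dist_common_neighbour[OF wf, of x v y]
      edge_dist_common_neighbour[OF wf, of y v x] complete_induced_dominates[OF KA] complete_induced_dominates[OF KB]
    by (auto simp: d_def)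
  \<comment> \<open>\<open>transmission\<close> sums distances towards a vertex, whereas matrix rows
    hold distances from it; symmetry reconciles the two.\<close>
  have d_sym: "d u w = d w u" if "u \<in> A \<union> B \<union> {v}" "w \<in> A \<union> B \<union> {v}" for u w
  proof (cases "u = w \<or> u \<in> A \<and> w \<in> B \<or> u \<in> B \<and> w \<in> A")
    case True
    then show ?thesis by (auto simp: d_AB)
  next
    case False
    then have "d u w = 1" "d w u = 1" using that by (intro d_adj; blast)+
    then show ?thesis by simp
  qed

  \<comment> \<open>Action of the distance Laplacian on vectors\<close>
  define t where "t u = transmission \<Gamma> u" for u
  define f where "f u w = complex_of_real ((if u = w then t u else 0) - d u w)" for u w
  have laplacian: "map_mat complex_of_real (distance_laplacian \<Gamma>) =
      Matrix.mat (length xs) (length xs) (\<lambda>(i, j). f (xs ! i) (xs ! j))"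
    by (intro eq_matI)
      (auto simp: distance_laplacian_def distance_matrix_def mat_diag_def f_def d_def t_def
        xs(3) xs_def[symmetric] nth_eq_iff_index_eq[OF xs(1)])
  have sum_d: "(\<Sum>w\<in>C. of_real (d u w) * g w) = sum g C - g u"
    if "u \<in> C" "C \<subseteq> A \<or> C \<subseteq> B" for u C and g :: "'v \<Rightarrow> complex"
  proof -
    have "finite C" using that fin finite_subset by blast
    moreover have "(\<Sum>w\<in>C - {u}. of_real (d u w) * g w) = sum g (C - {u})"
      using that by (intro sum.cong refl) (subst d_adj, auto)
    ultimately show ?thesis
      using that d_self[of u] by (auto simp: sum.remove[of C u])
  qed
  \<comment> \<open>Within a clique all distances are 1 except 0 on the diagonal, hence the
    correction \<open>- g u\<close>; the opposite clique has weight 2. Constant \<open>g = 1\<close>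
    yields the transmissions.\<close>
  have row_d: "(\<Sum>w\<in>A \<union> B \<union> {v}. of_real (d u w) * g w) =
     (if u \<in> A then sum g A - g u + 2 * sum g B + g v
      else if u \<in> B then 2 * sum g A + sum g B - g u + g v else sum g A + sum g B)"
    if u: "u \<in> A \<union> B \<union> {v}" for u and g :: "'v \<Rightarrow> complex"
  proof -
    consider "u \<in> A" | "u \<in> B" "u \<notin> A" | "u = v" "u \<notin> A" "u \<notin> B" using u disj by auto
    then show ?thesis
    proof cases
      case 1
      then show ?thesis unfolding sumV using disj
        by (subst sum_d) (auto simp: d_AB d_v sum_distrib_left)
    next
      case 2
      then show ?thesis unfolding sumV using disj
        by (subst (2) sum_d) (auto simp: d_AB d_v sum_distrib_left)
    next
      case 3
      have "(\<Sum>w\<in>A. of_real (d v w) * g w) = sum g A" "(\<Sum>w\<in>B. of_real (d v w) * g w) = sum g B"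
        by (auto intro!: sum.cong simp: d_v)
      with 3 show ?thesis unfolding sumV by (simp add: d_self)
    qed
  qed
  have t: "complex_of_real (t u) =
      (if u \<in> A then of_nat (a + 2 * b) else if u \<in> B then of_nat (2 * a + b) else of_nat (a + b))"
    if u: "u \<in> A \<union> B \<union> {v}" for u
  proof -
    have "complex_of_real (t u) = (\<Sum>w\<in>A \<union> B \<union> {v}. of_real (d w u) * 1)"
      by (simp add: t_def transmission_def V d_def)
    also have "\<dots> = (\<Sum>w\<in>A \<union> B \<union> {v}. of_real (d u w) * 1)"
      using d_sym u by (intro sum.cong) auto
    finally show ?thesis
      using row_d[OF u, of "\<lambda>_. 1"] by (simp add: card)
  qed
  \<comment> \<open>The \<open>+ 1\<close> beside the transmission restores the \<open>- g u\<close>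
    of \<open>row_d\<close>. The result depends on \<open>g\<close> only through \<open>g u\<close>,
    \<open>g v\<close> and its sums over \<open>A\<close> and \<open>B\<close>.\<close>
  have row: "(\<Sum>w\<in>A \<union> B \<union> {v}. f u w * g w) =
     (if u \<in> A then of_nat (a + 2 * b + 1) * g u - sum g A - 2 * sum g B - g v
      else if u \<in> B then of_nat (2 * a + b + 1) * g u - 2 * sum g A - sum g B - g v
      else of_nat (a + b) * g u - sum g A - sum g B)"
    if u: "u \<in> A \<union> B \<union> {v}" for u and g :: "'v \<Rightarrow> complex"
  proof -
    have "(\<Sum>w\<in>A \<union> B \<union> {v}. f u w * g w) =
      (\<Sum>w\<in>A \<union> B \<union> {v}. (if u = w then of_real (t u) * g w else 0) - of_real (d u w) * g w)"
      by (intro sum.cong) (auto simp: f_def algebra_simps)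
    also have "\<dots> = of_real (t u) * g u - (\<Sum>w\<in>A \<union> B \<union> {v}. of_real (d u w) * g w)"
      unfolding sum_subtractf using u fin by (subst sum.delta') auto
    finally show ?thesis
      unfolding row_d[OF u] t[OF u] by (auto simp: algebra_simps)
  qed

  \<comment> \<open>The eigenbasis and its independence\<close>
  obtain a\<^sub>0 b\<^sub>0 where a0: "a\<^sub>0 \<in> A" and b0: "b\<^sub>0 \<in> B"
    using ab card by (metis card.empty ex_in_conv not_one_le_zero)
  note neq0 = neq[OF a0 b0]
  \<comment> \<open>\<open>w\<close> is the coordinate and \<open>j\<close> the label. Differences
    take the labels in \<open>A - {a\<^sub>0}\<close> and \<open>B - {b\<^sub>0}\<close>, leaving
    exactly three labels for the other three vectors.\<close>
  define p :: "'v \<Rightarrow> 'v \<Rightarrow> complex" where "p w j =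
    (if j = v then 1
     else if j = a\<^sub>0 then (if w \<in> A then of_nat b else if w \<in> B then - of_nat a else 0)
     else if j = b\<^sub>0 then (if w = v then - of_nat (a + b) else 1)
     else if j \<in> A then of_bool (w = j) - of_bool (w = a\<^sub>0)
     else of_bool (w = j) - of_bool (w = b\<^sub>0))" for w j
  define l :: "'v \<Rightarrow> complex" where "l j =
    (if j = v then 0 else if j = a\<^sub>0 then of_nat (2 * (a + b) + 1)
     else if j = b\<^sub>0 then of_nat (a + b + 1)
     else if j \<in> A then of_nat (a + 2 * b + 1) else of_nat (2 * a + b + 1))" for j
  have pA: "p w j = of_bool (w = j) - of_bool (w = a\<^sub>0)" if "j \<in> A" "j \<noteq> a\<^sub>0" for w j
    using that disj b0 by (auto simp: p_def)
  have pB: "p w j = of_bool (w = j) - of_bool (w = b\<^sub>0)" if "j \<in> B" "j \<noteq> b\<^sub>0" for w j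
    using that disj a0 by (auto simp: p_def)
  \<comment> \<open>A difference sums to zero over its own clique and vanishes on the other
    one.\<close>
  have sum_pA: "(\<Sum>w\<in>A. p w j) =
      (if j = v then of_nat a else if j = a\<^sub>0 then of_nat (a * b) else if j = b\<^sub>0 then of_nat a else 0)"
    if "j \<in> A \<union> B \<union> {v}" for j
  proof -
    have "(\<Sum>w\<in>A. p w b\<^sub>0) = (\<Sum>w\<in>A. 1)"
      using neq0 disj by (intro sum.cong) (auto simp: p_def)
    moreover have "(\<Sum>w\<in>A. p w j) = 0" if "j \<in> A" "j \<noteq> a\<^sub>0"
      using that disj a0 b0 fin by (simp add: pA pB sum_subtractf)
    moreover have "(\<Sum>w\<in>A. p w j) = 0" if "j \<in> B" "j \<noteq> b\<^sub>0"
      using that disj a0 b0 by (intro sum.neutral) (auto simp: pA pB)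
    ultimately show ?thesis
      using that neq0 card by (auto simp: p_def)
  qed
  have sum_pB: "(\<Sum>w\<in>B. p w j) =
      (if j = v then of_nat b else if j = a\<^sub>0 then - of_nat (a * b) else if j = b\<^sub>0 then of_nat b else 0)"
    if "j \<in> A \<union> B \<union> {v}" for j
  proof -
    have "(\<Sum>w\<in>B. p w b\<^sub>0) = (\<Sum>w\<in>B. 1)"
      using neq0 disj by (intro sum.cong) (auto simp: p_def)
    moreover have "(\<Sum>w\<in>B. p w a\<^sub>0) = (\<Sum>w\<in>B. - of_nat a)"
      using neq0 disj by (intro sum.cong) (auto simp: p_def)
    moreover have "(\<Sum>w\<in>B. p w j) = 0" if "j \<in> A" "j \<noteq> a\<^sub>0"
      using that disj a0 b0 by (intro sum.neutral) (auto simp: pA pB)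
    moreover have "(\<Sum>w\<in>B. p w j) = 0" if "j \<in> B" "j \<noteq> b\<^sub>0"
      using that disj a0 b0 fin by (simp add: pA pB sum_subtractf)
    ultimately show ?thesis
      using that neq0 card by (auto simp: p_def)
  qed
  have "proots (char_poly (map_mat complex_of_real (distance_laplacian \<Gamma>))) = image_mset l (mset xs)"
    unfolding laplacian
  proof (rule proots_char_poly_eigenbasis[OF xs(1), where p = p], unfold xs(2))
    fix u j assume uj: "u \<in> A \<union> B \<union> {v}" "j \<in> A \<union> B \<union> {v}"
    show "(\<Sum>w\<in>A \<union> B \<union> {v}. f u w * p w j) = p u j * l j"
      using uj neq0 disj a0 b0 unfolding row[OF uj(1)] sum_pA[OF uj(2)] sum_pB[OF uj(2)]
      by (auto simp: p_def l_def algebra_simps)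
  next
    fix c :: "'v \<Rightarrow> complex" and j
    assume eq: "\<And>u. u \<in> A \<union> B \<union> {v} \<Longrightarrow> (\<Sum>j\<in>A \<union> B \<union> {v}. p u j * c j) = 0"
      and j: "j \<in> A \<union> B \<union> {v}"
    have expand: "(\<Sum>j\<in>A \<union> B \<union> {v}. p u j * c j) = p u a\<^sub>0 * c a\<^sub>0 + p u b\<^sub>0 * c b\<^sub>0 + c v
      + (\<Sum>j\<in>A - {a\<^sub>0}. (of_bool (u = j) - of_bool (u = a\<^sub>0)) * c j)
      + (\<Sum>j\<in>B - {b\<^sub>0}. (of_bool (u = j) - of_bool (u = b\<^sub>0)) * c j)" for u
    proof -
      have "(\<Sum>j\<in>A - {a\<^sub>0}. p u j * c j) = (\<Sum>j\<in>A - {a\<^sub>0}. (of_bool (u = j) - of_bool (u = a\<^sub>0)) * c j)"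
        by (intro sum.cong) (auto simp: pA)
      moreover have "(\<Sum>j\<in>B - {b\<^sub>0}. p u j * c j) = (\<Sum>j\<in>B - {b\<^sub>0}. (of_bool (u = j) - of_bool (u = b\<^sub>0)) * c j)"
        by (intro sum.cong) (auto simp: pB)
      ultimately show ?thesis
        unfolding sumV sum.remove[OF fin(1) a0] sum.remove[OF fin(2) b0] by (simp add: p_def)
    qed
    \<comment> \<open>At a vertex outside a clique its differences vanish, so each coordinate
      equation involves those of at most one clique.\<close>
    have away: "(\<Sum>j\<in>C - {x}. (of_bool (u = j) - of_bool (u = x)) * c j) = 0"
      if "u \<notin> C" "x \<in> C" for u x C
      using that by (intro sum.neutral) auto
    show "c j = 0"
    proof (rule two_cliques_eigenvectors_independent[OF fin a0 b0 _ _ _ j], unfold card)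
      fix u assume u: "u \<in> A"
      then have "u \<notin> B" "u \<noteq> v" using disj by auto
      then show "(\<Sum>j\<in>A - {a\<^sub>0}. (of_bool (u = j) - of_bool (u = a\<^sub>0)) * c j)
          + of_nat b * c a\<^sub>0 + c b\<^sub>0 + c v = 0"
        using eq[of u] u neq0 away[OF _ b0] unfolding expand by (simp add: p_def ac_simps)
    next
      fix u assume u: "u \<in> B"
      then have "u \<notin> A" "u \<noteq> v" using disj by auto
      then show "(\<Sum>j\<in>B - {b\<^sub>0}. (of_bool (u = j) - of_bool (u = b\<^sub>0)) * c j)
          - of_nat a * c a\<^sub>0 + c b\<^sub>0 + c v = 0"
        using eq[of u] u neq0 away[OF _ a0] unfolding expand by (simp add: p_def algebra_simps)
    next
      \<comment> \<open>Only the columns \<open>v\<close> and \<open>b\<^sub>0\<close> are nonzero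
        at the coordinate \<open>v\<close>.\<close>
      show "c v = of_nat (a + b) * c b\<^sub>0"
        using eq[of v] disj neq0 away[OF disj(2) a0] away[OF disj(3) b0] unfolding expand
        by (simp add: p_def algebra_simps add_eq_0_iff)
    qed
  qed

  \<comment> \<open>Multiplicities of the eigenvalues\<close>
  moreover have "mset xs = mset_set (A \<union> B \<union> {v})"
    using xs by (metis mset_set_set)
  \<comment> \<open>Splitting off \<open>a\<^sub>0\<close> and \<open>b\<^sub>0\<close> accounts for
    the \<open>- 1\<close> in the multiplicities of the difference eigenvalues.\<close>
  moreover have "image_mset l (mset_set (A \<union> B \<union> {v})) =
      {#l v, l a\<^sub>0, l b\<^sub>0#} + image_mset l (mset_set (A - {a\<^sub>0})) + image_mset l (mset_set (B - {b\<^sub>0}))"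
  proof -
    have "mset_set (A \<union> B \<union> {v}) = mset_set A + mset_set B + mset_set {v}"
      using fin disj by (simp add: mset_set_Union)
    also have "mset_set A = add_mset a\<^sub>0 (mset_set (A - {a\<^sub>0}))"
      using fin a0 by (simp add: mset_set.remove)
    also have "mset_set B = add_mset b\<^sub>0 (mset_set (B - {b\<^sub>0}))"
      using fin b0 by (simp add: mset_set.remove)
    finally show ?thesis by simp
  qed
  moreover have "image_mset l (mset_set (A - {a\<^sub>0})) = replicate_mset (a - 1) (of_nat (a + 2 * b + 1))"
  proof -
    have "image_mset l (mset_set (A - {a\<^sub>0})) = image_mset (\<lambda>_. of_nat (a + 2 * b + 1)) (mset_set (A - {a\<^sub>0}))"
      using fin neq0 disj by (intro image_mset_cong) (auto simp: l_def)
    then show ?thesis using fin a0 card by (simp add: image_mset_const_eq)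
  qed
  moreover have "image_mset l (mset_set (B - {b\<^sub>0})) = replicate_mset (b - 1) (of_nat (2 * a + b + 1))"
  proof -
    have "image_mset l (mset_set (B - {b\<^sub>0})) = image_mset (\<lambda>_. of_nat (2 * a + b + 1)) (mset_set (B - {b\<^sub>0}))"
      using fin neq0 disj by (intro image_mset_cong) (auto simp: l_def)
    then show ?thesis using fin b0 card by (simp add: image_mset_const_eq)
  qed
  moreover have "l v = 0" "l a\<^sub>0 = of_nat (2 * (a + b) + 1)" "l b\<^sub>0 = of_nat (a + b + 1)"
    using neq0 by (auto simp: l_def)
  ultimately show ?thesis
    by (simp add: distance_laplacian_spectrum_def ac_simps)
qed

section \<open>Application to the character degree graph\<close>

theorem corollary3p13:
  fixes G :: "('a, 'b) monoid_scheme" and n n\<^sub>1 :: nat and v :: nat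
  assumes "n \<ge> 3"
    and "group G" and "finite (carrier G)" and "solvable G"
    and "card (verts (with_proj (character_degree_graph G))) = n"
    and "graph_diameter (with_proj (character_degree_graph G)) = 2"
    and "\<not> is_block (with_proj (character_degree_graph G))"
    and "1 \<le> n\<^sub>1" and "n\<^sub>1 \<le> n - (n\<^sub>1 + 1)"
    and "two_cliques_at (with_proj (character_degree_graph G)) (n - (n\<^sub>1 + 1)) v n\<^sub>1"
  shows "distance_laplacian_spectrum (with_proj (character_degree_graph G)) =
           replicate_mset 1 0
         + replicate_mset 1 (2 * of_nat n - 1)
         + replicate_mset 1 (of_nat n)
         + replicate_mset (n\<^sub>1 - 1) (2 * of_nat n - (of_nat n\<^sub>1 + 1))
         + replicate_mset (n - (n\<^sub>1 + 2)) (of_nat n + of_nat n\<^sub>1)"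
proof -
  have wf: "wf_digraph (with_proj (character_degree_graph G))"
    by unfold_locales (auto simp: character_degree_graph_def)
  define a where "a = n - (n\<^sub>1 + 1)"
  \<comment> \<open>Since \<open>1 \<le> n\<^sub>1 \<le> n - (n\<^sub>1 + 1)\<close>, the natural
    subtraction does not truncate.\<close>
  have n: "n = a + n\<^sub>1 + 1" and a: "1 \<le> a" using assms(8,9) by (auto simp: a_def)
  \<comment> \<open>With \<open>b = n\<^sub>1\<close>: \<open>2 * (a + b) + 1\<close> is
    \<open>2n - 1\<close>, \<open>a + b + 1\<close> is \<open>n\<close>,
    \<open>2 * a + b + 1\<close> is \<open>2n - (n\<^sub>1 + 1)\<close>,
    \<open>a + 2 * b + 1\<close> is \<open>n + n\<^sub>1\<close>, and \<open>a - 1\<close> is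
    \<open>n - (n\<^sub>1 + 2)\<close>.\<close>
  show ?thesis
    using distance_laplacian_spectrum_two_cliques[OF wf assms(10) a[unfolded a_def] assms(8)]
    unfolding a_def[symmetric] by (simp add: n algebra_simps)
qed

end
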